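(* Let $\Gamma$ be an infinite abelian group, $F\colon\Gamma\to\Gamma$ an injective endomorphism, $r>0$, and $\lambda$ a length function for $(\Gamma,F^r)$. Then $A\subseteq\Gamma$ is $F$-sparse if and only if $A$ is $F$-automatic and $\lambda$-sparse.
   Context: For a string $\sigma=s_0\cdots s_n$ of elements of $\Gamma$ and an endomorphism $G$, $[\sigma]_G=s_0+Gs_1+\cdots+G^ns_n$; for a set $L$ of strings $[L]_G=\{[\sigma]_G:\sigma\in L\}$. $\Lambda^*$ denotes finite strings over $\Lambda$. A finite $\Sigma\subseteq\Gamma$ is a $G$-spanning set if: (i) every $a\in\Gamma$ equals $[\sigma]_G$ for some $\sigma\in\Sigma^*$; (ii) $0\in\Sigma$ and $\Sigma=-\Sigma$; (iii) for $a_1,\dots,a_5\in\Sigma$, $a_1+\cdots+a_5\in\Sigma+G\Sigma$; (iv) if $a_1,a_2,a_3\in\Sigma$ and $a_1+a_2+a_3\in G\Gamma$ then $a_1+a_2+a_3\in G\Sigma$. $A$ is $F$-automatic if there are $r'>0$ and an $F^{r'}$-spanning set $\Sigma$ with $\{\sigma\in\Sigma^*:[\sigma]_{F^{r'}}\in A\}$ regular. A language $L\subseteq\Sigma^*$ is sparse if it is regular and $|\{\sigma\in L:|\sigma|\le x\}|$ is bounded by a polynomial in $x$. $A$ is $F$-sparse if there are $r'>0$, an $F^{r'}$-spanning set $\Sigma$ and a sparse $L\subseteq\Sigma^*$ with $A=[L]_{F^{r'}}$. A length function for $(\Gamma,G)$ is $\lambda\colon\Gamma\to\mathbb{R}_{\ge0}$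 with: $\lambda(a)=\lambda(-a)$; some $D\ge1$ with $\lambda(a+b)\le D\max(\lambda(a),\lambda(b))$; for every $N$ only finitely many $a$ with $\lambda(a)\le N$; a finite set $A_0$ and reals $C>1$, $E\ge1$ with $\lambda(Ga)\le C\lambda(a)$ for all $a$ and $\lambda(G^na)\ge\frac{C^n}{E}\lambda(a)$ for all $a\notin A_0$, $n\in\mathbb{N}$. For a length function $\lambda$, $A$ is $\lambda$-sparse if $f_{A,\lambda}(x)=|\{a\in A:\lambda(a)\le x\}|$ is $O(\log(x)^d)$ for some $d\in\mathbb{N}$. *)

theory Defs
  imports Complex_Main "HOL-Library.Landau_Symbols" "HOL-Computational_Algebra.Polynomial"
begin

text \<open>Strings over the group are lists; the empty string has value \<open>0\<close>.\<close>

definition string_value :: "('a::ab_group_add \<Rightarrow> 'a) \<Rightarrow> 'a list \<Rightarrow> 'a" where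
  "string_value G w = (\<Sum>i<length w. (G ^^ i) (w ! i))"

definition spanning_set :: "('a::ab_group_add \<Rightarrow> 'a) \<Rightarrow> 'a set \<Rightarrow> bool" where
  "spanning_set G S \<longleftrightarrow>
     finite S \<and>
     (\<forall>a. \<exists>w\<in>lists S. a = string_value G w) \<and>
     0 \<in> S \<and> S = uminus ` S \<and>
     (\<forall>a\<^sub>1\<in>S. \<forall>a\<^sub>2\<in>S. \<forall>a\<^sub>3\<in>S. \<forall>a\<^sub>4\<in>S. \<forall>a\<^sub>5\<in>S.
        \<exists>b\<in>S. \<exists>c\<in>S. a\<^sub>1 + a\<^sub>2 + a\<^sub>3 + a\<^sub>4 + a\<^sub>5 = b + G c) \<and>
     (\<forall>a\<^sub>1\<in>S. \<forall>a\<^sub>2\<in>S. \<forall>a\<^sub>3\<in>S. a\<^sub>1 + a\<^sub>2 + a\<^sub>3 \<in> range G \<longrightarrow> a\<^sub>1 + a\<^sub>2 + a\<^sub>3 \<in> G ` S)"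

text \<open>Recognition by a complete deterministic finite automaton over the alphabet \<open>S\<close>.
  Taking the states to be natural numbers loses no generality, since the state set \<open>Q\<close> is finite.\<close>

definition regular_language :: "'a set \<Rightarrow> 'a list set \<Rightarrow> bool" where
  "regular_language S L \<longleftrightarrow>
     (\<exists>(Q :: nat set) \<delta> q\<^sub>0 Acc.
        finite Q \<and> q\<^sub>0 \<in> Q \<and> Acc \<subseteq> Q \<and> (\<forall>q\<in>Q. \<forall>s\<in>S. \<delta> q s \<in> Q) \<and>
        L = {w \<in> lists S. foldl \<delta> q\<^sub>0 w \<in> Acc})"

text \<open>Only used for a finite alphabet \<open>S\<close>, so that the cardinality below is that of a finite set.\<close>

definition sparse_language :: "'a set \<Rightarrow> 'a list set \<Rightarrow> bool" where
  "sparse_language S L \<longleftrightarrow>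
     regular_language S L \<and>
     (\<exists>p :: real poly. \<forall>x :: nat. real (card {w \<in> L. length w \<le> x}) \<le> poly p (real x))"

definition automatic_set :: "('a::ab_group_add \<Rightarrow> 'a) \<Rightarrow> 'a set \<Rightarrow> bool" where
  "automatic_set F A \<longleftrightarrow>
     (\<exists>r'>0. \<exists>S. spanning_set (F ^^ r') S \<and>
        regular_language S {w \<in> lists S. string_value (F ^^ r') w \<in> A})"

definition sparse_set :: "('a::ab_group_add \<Rightarrow> 'a) \<Rightarrow> 'a set \<Rightarrow> bool" where
  "sparse_set F A \<longleftrightarrow>
     (\<exists>r'>0. \<exists>S L. spanning_set (F ^^ r') S \<and> sparse_language S L \<and>
        A = string_value (F ^^ r') ` L)"

definition length_function :: "('a::ab_group_add \<Rightarrow> 'a) \<Rightarrow> ('a \<Rightarrow> real) \<Rightarrow> bool" where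
  "length_function G len \<longleftrightarrow>
     (\<forall>a. 0 \<le> len a) \<and>
     (\<forall>a. len a = len (- a)) \<and>
     (\<exists>D\<ge>1. \<forall>a b. len (a + b) \<le> D * max (len a) (len b)) \<and>
     (\<forall>N. finite {a. len a \<le> N}) \<and>
     (\<exists>A\<^sub>0 C E. finite A\<^sub>0 \<and> C > 1 \<and> E \<ge> 1 \<and>
        (\<forall>a. len (G a) \<le> C * len a) \<and>
        (\<forall>a n. a \<notin> A\<^sub>0 \<longrightarrow> len ((G ^^ n) a) \<ge> C ^ n / E * len a))"

definition length_sparse :: "('a \<Rightarrow> real) \<Rightarrow> 'a set \<Rightarrow> bool" where
  "length_sparse len A \<longleftrightarrow>
     (\<exists>d :: nat. (\<lambda>x :: real. real (card {a \<in> A. len a \<le> x})) \<in> O[at_top](\<lambda>x. ln x ^ d))"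

end

theory Submission
  imports Defs
begin

text \<open>By condition (iv) of a spanning set, the difference of the values of two words of length \<open>n\<close>
  is of the form \<open>G\<^sup>n c\<close> only for \<open>c \<in> \<Sigma>\<close>; so a finite automaton reading two words in parallel can
  decide whether they have the same value. Projection (the subset construction) shows that the
  preimage of the values of a regular language is regular, and that every automatic set has a regular
  language of representatives, at most one for each length. For the counting, the length \<open>n\<close> of a
  shortest word for \<open>a\<close> and \<open>log \<lambda>(a)\<close> bound each other up to affine functions, apart from finitely
  many \<open>a\<close>; hence polynomial growth in \<open>n\<close> corresponds to polylogarithmic growth in \<open>\<lambda>\<close>. In the
  sparse-to-automatic direction, a word of the sparse language may be replaced by one whose length
  exceeds that of a shortest word by a bounded amount, since the part after the first \<open>n\<close> letters
  matters only through a carry in \<open>\<Sigma>\<close> and a state of the automaton.\<close>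

section \<open>Regularity from finite state information; bounds for polynomials and length
  functions\<close>

text \<open>As in the Myhill-Nerode theorem, the values of \<open>f\<close> on words serve as
  states, coded as natural numbers. \<open>step\<close> makes the transition well defined and
  \<open>acc\<close> lets acceptance depend on the value of \<open>f\<close> only.\<close>

lemma regular_languageI:
  fixes f :: "'a list \<Rightarrow> 'b"
  assumes fin: "finite (f ` lists S)" and sub: "L \<subseteq> lists S"
    and step: "\<And>u v s. u \<in> lists S \<Longrightarrow> v \<in> lists S \<Longrightarrow> s \<in> S \<Longrightarrow> f u = f v \<Longrightarrow> f (u @ [s]) = f (v @ [s])"
    and acc: "\<And>u v. u \<in> L \<Longrightarrow> v \<in> lists S \<Longrightarrow> f u = f v \<Longrightarrow> v \<in> L"
  shows "regular_language S L"
proof -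
  obtain e :: "'b \<Rightarrow> nat" where e: "inj_on e (f ` lists S)"
    using fin finite_imp_inj_to_nat_seg by blast
  define rep where "rep q = (SOME w. w \<in> lists S \<and> e (f w) = q)" for q
  have rep: "rep (e (f w)) \<in> lists S \<and> f (rep (e (f w))) = f w" if "w \<in> lists S" for w
  proof -
    have *: "rep (e (f w)) \<in> lists S \<and> e (f (rep (e (f w)))) = e (f w)"
      unfolding rep_def by (rule someI[of _ w]) (use that in simp)
    then show ?thesis using e that by (auto dest: inj_onD)
  qed
  \<comment> \<open>The letter is appended to a chosen word for the state; \<open>step\<close> makes
    the choice irrelevant.\<close>
  define \<delta> where "\<delta> q s = e (f (rep q @ [s]))" for q s
  have step': "\<delta> (e (f w)) s = e (f (w @ [s]))" if "w \<in> lists S" "s \<in> S" for w s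
    unfolding \<delta>_def using step[of "rep (e (f w))" w s] rep[of w] that by simp
  have run: "foldl \<delta> (e (f [])) w = e (f w)" if "w \<in> lists S" for w
    using that by (induction w rule: rev_induct) (simp_all add: step')
  have "L = {w \<in> lists S. foldl \<delta> (e (f [])) w \<in> e ` f ` L}"
  proof (intro equalityI subsetI)
    fix w assume "w \<in> L"
    then show "w \<in> {w \<in> lists S. foldl \<delta> (e (f [])) w \<in> e ` f ` L}"
      using sub run[of w] by auto
  next
    fix w assume w: "w \<in> {w \<in> lists S. foldl \<delta> (e (f [])) w \<in> e ` f ` L}"
    then obtain u where u: "u \<in> L" "e (f w) = e (f u)" using run[of w] by auto
    then have "f u = f w" using e w sub by (auto dest!: inj_onD)
    then show "w \<in> L" using acc[of u w] u w by simp
  qed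
  moreover have "\<forall>q\<in>e ` f ` lists S. \<forall>s\<in>S. \<delta> q s \<in> e ` f ` lists S"
  proof (intro ballI)
    fix q s assume q: "q \<in> e ` f ` lists S" and s: "s \<in> S"
    then obtain w where w: "w \<in> lists S" "q = e (f w)" by blast
    have "w @ [s] \<in> lists S" using w s by simp
    then show "\<delta> q s \<in> e ` f ` lists S" unfolding w(2) step'[OF w(1) s] by blast
  qed
  moreover have "finite (e ` f ` lists S)" "e (f []) \<in> e ` f ` lists S" "e ` f ` L \<subseteq> e ` f ` lists S"
    using fin sub by auto
  ultimately show ?thesis unfolding regular_language_def by blast
qed

text \<open>Induction along the Horner scheme. The base \<open>y + 1\<close> is at least 1, so
  constants are absorbed into every power of it.\<close>

lemma poly_le_power:
  fixes p :: "real poly"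
  obtains c d where "c > 0" "\<And>y. y \<ge> 0 \<Longrightarrow> poly p y \<le> c * (y + 1) ^ d"
proof -
  have "\<exists>c>0. \<exists>d. \<forall>y\<ge>0. poly p y \<le> c * (y + 1) ^ d"
  proof (induction p)
    case 0
    show ?case by (intro exI[of _ 1] conjI exI[of _ 0]) auto
  next
    case (pCons a p)
    then obtain c d where c: "c > 0" "\<And>y. y \<ge> 0 \<Longrightarrow> poly p y \<le> c * (y + 1) ^ d" by blast
    have "poly (pCons a p) y \<le> (\<bar>a\<bar> + c) * (y + 1) ^ Suc d" if y: "y \<ge> 0" for y
    proof -
      have "y * poly p y \<le> (y + 1) * (c * (y + 1) ^ d)"
      proof -
        have "y * poly p y \<le> y * (c * (y + 1) ^ d)" using c(2)[OF y] y by (rule mult_left_mono)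
        also have "\<dots> \<le> (y + 1) * (c * (y + 1) ^ d)" using c(1) y by (intro mult_right_mono) auto
        finally show ?thesis .
      qed
      moreover have "\<bar>a\<bar> * 1 \<le> \<bar>a\<bar> * (y + 1) ^ Suc d"
        using y by (intro mult_left_mono one_le_power) auto
      ultimately show ?thesis by (simp add: algebra_simps)
    qed
    then show ?case using c(1) by (intro exI[of _ "\<bar>a\<bar> + c"] conjI exI[of _ "Suc d"]) auto
  qed
  then show ?thesis using that by blast
qed

lemma additive_funpow:
  fixes G :: "'a::ab_group_add \<Rightarrow> 'a"
  assumes "additive G" shows "additive (G ^^ n)"
  using assms by (induction n) (auto simp: additive_def)

text \<open>Passing to a power of the endomorphism raises \<open>C\<close> but keeps the constant \<open>D\<close> of the
  ultrametric-like inequality, so \<open>D \<le> C\<close> can be arranged; then long sums do not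
  accumulate factors of \<open>D\<close>.\<close>

lemma length_function_powerE:
  assumes "length_function H len" "j > 0"
  obtains k D C E A\<^sub>0 where "k > 0" "D \<ge> 1" "C > 1" "D \<le> C" "E \<ge> 1" "finite A\<^sub>0"
    "\<And>a b. len (a + b) \<le> D * max (len a) (len b)"
    "\<And>a. len ((H ^^ (j * k)) a) \<le> C * len a"
    "\<And>a n. a \<notin> A\<^sub>0 \<Longrightarrow> C ^ n / E * len a \<le> len ((H ^^ (j * k * n)) a)"
proof -
  obtain D A\<^sub>0 C E where D: "D \<ge> 1" "\<And>a b. len (a + b) \<le> D * max (len a) (len b)"
    and fin: "finite A\<^sub>0" and C: "C > 1" and E: "E \<ge> 1"
    and up: "\<And>a. len (H a) \<le> C * len a"
    and low: "\<And>a n. a \<notin> A\<^sub>0 \<Longrightarrow> len ((H ^^ n) a) \<ge> C ^ n / E * len a"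
    using assms(1) unfolding length_function_def by metis
  obtain k where k: "D < C ^ k" using C real_arch_pow by blast
  have "k > 0" using k D by (cases k) auto
  have iter: "len ((H ^^ n) a) \<le> C ^ n * len a" for n a
  proof (induction n)
    case (Suc n)
    have "len ((H ^^ Suc n) a) \<le> C * len ((H ^^ n) a)" using up by simp
    also have "\<dots> \<le> C * (C ^ n * len a)" using C Suc by (intro mult_left_mono) auto
    finally show ?case by simp
  qed simp
  show ?thesis
  proof (rule that[of k D "C ^ (j * k)" E A\<^sub>0])
    have "C ^ k \<le> C ^ (j * k)" using C assms(2) by (intro power_increasing) auto
    then show "D \<le> C ^ (j * k)" using k by simp
    show "C ^ (j * k) > 1" using C assms(2) \<open>k > 0\<close> by (intro one_less_power) auto
    show "(C ^ (j * k)) ^ n / E * len a \<le> len ((H ^^ (j * k * n)) a)" if "a \<notin> A\<^sub>0" for a n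
      using low[OF that, of "j * k * n"] by (simp add: power_mult)
  qed (use D fin E iter \<open>k > 0\<close> in auto)
qed

section \<open>Values of words\<close>

lemma string_value_Nil [simp]: "string_value G [] = 0"
  by (simp add: string_value_def)

lemma string_value_snoc: "string_value G (w @ [s]) = string_value G w + (G ^^ length w) s"
  by (simp add: string_value_def nth_append)

lemma string_value_append:
  assumes "additive G"
  shows "string_value G (u @ v) = string_value G u + (G ^^ length u) (string_value G v)"
proof (induction v rule: rev_induct)
  case Nil
  show ?case by (simp add: additive.zero[OF additive_funpow[OF assms]])
next
  case (snoc s v)
  have "string_value G (u @ v @ [s]) = string_value G ((u @ v) @ [s])" by simp
  also have "\<dots> = string_value G u + (G ^^ length u) (string_value G v) + (G ^^ (length u + length v)) s"
    unfolding string_value_snoc snoc by simp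
  finally show ?case
    by (simp add: string_value_snoc additive.add[OF additive_funpow[OF assms]] funpow_add add.assoc)
qed

lemma string_value_pad:
  assumes "additive G"
  shows "string_value G (w @ replicate k 0) = string_value G w"
proof -
  have "string_value G (replicate k 0) = 0"
    by (simp add: string_value_def additive.zero[OF additive_funpow[OF assms]])
  then show ?thesis
    by (simp add: string_value_append[OF assms] additive.zero[OF additive_funpow[OF assms]])
qed

section \<open>Carries between words over a spanning set\<close>

locale spanned_group =
  fixes G :: "'a::ab_group_add \<Rightarrow> 'a" and S :: "'a set"
  assumes additive_G: "additive G" and inj_G: "inj G" and spanning: "spanning_set G S"
begin

abbreviation val :: "'a list \<Rightarrow> 'a" where "val \<equiv> string_value G"

lemmas power_add = additive.add[OF additive_funpow[OF additive_G]]
  and power_zero = additive.zero[OF additive_funpow[OF additive_G]]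
  and power_diff = additive.diff[OF additive_funpow[OF additive_G]]

lemma finite_S: "finite S" and zero_S: "0 \<in> S" and minus_S: "s \<in> S \<Longrightarrow> - s \<in> S"
  and ex_word: "\<exists>w\<in>lists S. val w = a"
proof -
  note * = spanning[unfolded spanning_set_def]
  show "finite S" "0 \<in> S" using * by simp_all
  show "- s \<in> S" if "s \<in> S" using * that by (metis imageI)
  show "\<exists>w\<in>lists S. val w = a" using * by metis
qed

text \<open>Condition (iv) of a spanning set, with \<open>G\<close> cancelled by
  injectivity.\<close>

lemma sum3_S: "a \<in> S \<Longrightarrow> b \<in> S \<Longrightarrow> c \<in> S \<Longrightarrow> a + b + c = G x \<Longrightarrow> x \<in> S"
  using spanning inj_G unfolding spanning_set_def
  by (metis inj_image_mem_iff rangeI)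

text \<open>The recursion for carries: the carry \<open>c\<close> after the last letters determines
  the carry \<open>G c - s + t\<close> before them.\<close>

lemma carry_snoc:
  assumes "length \<tau> = length w"
  shows "val (w @ [s]) = val (\<tau> @ [t]) + (G ^^ Suc (length w)) c \<longleftrightarrow>
         val w = val \<tau> + (G ^^ length w) (G c - s + t)"
  by (simp add: string_value_snoc assms power_add power_diff funpow_Suc_right del: funpow.simps)
     (auto simp: algebra_simps)

text \<open>The carry before the last letters lies in \<open>S\<close> by induction, so
  \<open>G c\<close> is a sum of three elements of \<open>S\<close>, and \<open>sum3_S\<close>
  applies.\<close>

lemma carry_in_S:
  assumes "length \<tau> = length w" "w \<in> lists S" "\<tau> \<in> lists S"
    and "val w = val \<tau> + (G ^^ length w) c"
  shows "c \<in> S"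
  using assms
proof (induction w arbitrary: \<tau> c rule: rev_induct)
  case Nil
  then show ?case by (simp add: zero_S)
next
  case (snoc s w)
  then obtain \<tau>' t where \<tau>: "\<tau> = \<tau>' @ [t]" by (cases \<tau> rule: rev_cases) auto
  have "val w = val \<tau>' + (G ^^ length w) (G c - s + t)"
    using snoc.prems carry_snoc[of \<tau>' w s t c] by (simp add: \<tau>)
  then have "G c - s + t \<in> S" using snoc by (simp add: \<tau>)
  moreover have "s \<in> S" "- t \<in> S" using snoc.prems minus_S by (auto simp: \<tau>)
  moreover have "(G c - s + t) + s + (- t) = G c" by simp
  ultimately show ?case by (rule sum3_S)
qed

lemma carry_in_S_le:
  assumes "length \<tau> \<le> length w" "w \<in> lists S" "\<tau> \<in> lists S"
    and "val w = val \<tau> + (G ^^ length w) c"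
  shows "c \<in> S"
proof (rule carry_in_S)
  show "val w = val (\<tau> @ replicate (length w - length \<tau>) 0) + (G ^^ length w) c"
    using assms by (simp add: string_value_pad[OF additive_G])
qed (use assms zero_S in auto)

section \<open>Regularity of preimages and bounded excess length\<close>

text \<open>While reading \<open>w\<close>, all words of \<open>L\<close> are followed at once, each
  remembered only through its state and its carry, or its carry alone once it has ended. Carries lie
  in \<open>S\<close>, so only finitely many pairs \<open>(R w, E w)\<close> occur.\<close>

lemma regular_preimage:
  assumes "regular_language S L"
  shows "regular_language S {w \<in> lists S. val w \<in> val ` L}"
proof -
  obtain Q :: "nat set" and \<delta> q0 Acc where fin: "finite Q" and q0: "q0 \<in> Q" and Acc: "Acc \<subseteq> Q"
    and \<delta>: "\<And>q s. q \<in> Q \<Longrightarrow> s \<in> S \<Longrightarrow> \<delta> q s \<in> Q"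
    and L: "L = {w \<in> lists S. foldl \<delta> q0 w \<in> Acc}"
    using assms unfolding regular_language_def by blast
  have run: "foldl \<delta> q0 w \<in> Q" if "w \<in> lists S" for w
    using that by (induction w rule: rev_induct) (auto simp: q0 \<delta>)
  \<comment> \<open>\<open>R w\<close> records the carries against (prefixes of) words at least as long as \<open>w\<close>,
    \<open>E w\<close> those against words of \<open>L\<close> that have already ended and are continued by zeros.\<close>
  define R where "R w = {(foldl \<delta> q0 \<tau>, c) | \<tau> c. \<tau> \<in> lists S \<and> length \<tau> = length w \<and>
      val w = val \<tau> + (G ^^ length w) c}" for w
  define E where "E w = {c. \<exists>\<tau>\<in>L. length \<tau> \<le> length w \<and> val w = val \<tau> + (G ^^ length w) c}" for w
  have R_snoc: "R (w @ [s]) = {(\<delta> q t, c) | q t c. t \<in> S \<and> (q, G c - s + t) \<in> R w}" for w s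
  proof (intro equalityI subsetI)
    fix x assume "x \<in> R (w @ [s])"
    then obtain \<tau> c where x: "x = (foldl \<delta> q0 \<tau>, c)" and \<tau>: "\<tau> \<in> lists S" "length \<tau> = Suc (length w)"
      "val (w @ [s]) = val \<tau> + (G ^^ Suc (length w)) c"
      unfolding R_def by auto
    then obtain \<tau>' t where \<tau>': "\<tau> = \<tau>' @ [t]" by (cases \<tau> rule: rev_cases) auto
    have "val w = val \<tau>' + (G ^^ length w) (G c - s + t)"
      using \<tau> carry_snoc[of \<tau>' w s t c] by (simp add: \<tau>')
    then have "(foldl \<delta> q0 \<tau>', G c - s + t) \<in> R w" unfolding R_def using \<tau> \<tau>' by auto
    then show "x \<in> {(\<delta> q t, c) | q t c. t \<in> S \<and> (q, G c - s + t) \<in> R w}"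
      using x \<tau> \<tau>' by auto
  next
    fix x assume "x \<in> {(\<delta> q t, c) | q t c. t \<in> S \<and> (q, G c - s + t) \<in> R w}"
    then obtain \<tau> t c where x: "x = (\<delta> (foldl \<delta> q0 \<tau>) t, c)" and t: "t \<in> S"
      and \<tau>: "\<tau> \<in> lists S" "length \<tau> = length w" "val w = val \<tau> + (G ^^ length w) (G c - s + t)"
      unfolding R_def by auto
    have "val (w @ [s]) = val (\<tau> @ [t]) + (G ^^ Suc (length w)) c"
      using carry_snoc \<tau> by blast
    then show "x \<in> R (w @ [s])" unfolding R_def using x t \<tau>
      by (auto intro!: exI[of _ "\<tau> @ [t]"])
  qed
  \<comment> \<open>A word that ended earlier is continued by the letter 0, whence
    \<open>G c - s\<close>; a word ending exactly now is read off from the accepting states in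
    \<open>R (w @ [s])\<close>.\<close>
  have E_snoc: "E (w @ [s]) = {c. G c - s \<in> E w} \<union> {c. \<exists>q\<in>Acc. (q, c) \<in> R (w @ [s])}" for w s
  proof -
    have shift: "(val (w @ [s]) = val \<tau> + (G ^^ Suc (length w)) c) \<longleftrightarrow>
        (val w = val \<tau> + (G ^^ length w) (G c - s))" for \<tau> c
      by (simp add: string_value_snoc power_diff funpow_Suc_right del: funpow.simps)
         (auto simp: algebra_simps)
    have "c \<in> E (w @ [s]) \<longleftrightarrow> (\<exists>\<tau>\<in>L. length \<tau> \<le> length w \<and>
        val (w @ [s]) = val \<tau> + (G ^^ Suc (length w)) c) \<or> (\<exists>\<tau>\<in>L. length \<tau> = Suc (length w) \<and>
        val (w @ [s]) = val \<tau> + (G ^^ Suc (length w)) c)" for c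
      unfolding E_def length_append_singleton le_Suc_eq by blast
    moreover have "(\<exists>\<tau>\<in>L. length \<tau> = Suc (length w) \<and>
        val (w @ [s]) = val \<tau> + (G ^^ Suc (length w)) c) \<longleftrightarrow> (\<exists>q\<in>Acc. (q, c) \<in> R (w @ [s]))" for c
      unfolding R_def L length_append_singleton by blast
    moreover have "(\<exists>\<tau>\<in>L. length \<tau> \<le> length w \<and>
        val (w @ [s]) = val \<tau> + (G ^^ Suc (length w)) c) \<longleftrightarrow> G c - s \<in> E w" for c
      unfolding shift E_def by blast
    ultimately show ?thesis by blast
  qed
  have "finite ((\<lambda>w. (R w, E w)) ` lists S)"
  proof (rule finite_subset)
    show "(\<lambda>w. (R w, E w)) ` lists S \<subseteq> Pow (Q \<times> S) \<times> Pow S"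
      unfolding R_def E_def L using run carry_in_S carry_in_S_le by blast
  qed (simp add: fin finite_S)
  then show ?thesis
  proof (rule regular_languageI)
    fix u v s assume "(R u, E u) = (R v, E v)"
    then show "(R (u @ [s]), E (u @ [s])) = (R (v @ [s]), E (v @ [s]))"
      by (simp add: R_snoc E_snoc)
  next
    \<comment> \<open>A word of \<open>L\<close> longer than \<open>w\<close> splits into a prefix
      as long as \<open>w\<close> and a rest \<open>\<rho>\<close> whose value is the carry. Whether
      a suitable \<open>\<rho>\<close> exists depends only on the pair
      \<open>(q, c)\<close>.\<close>
    have acc: "val w \<in> val ` L \<longleftrightarrow>
        0 \<in> E w \<or> (\<exists>(q, c)\<in>R w. \<exists>\<rho>\<in>lists S. foldl \<delta> q \<rho> \<in> Acc \<and> c = val \<rho>)" for w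
    proof
      assume "val w \<in> val ` L"
      then obtain \<sigma> where \<sigma>: "\<sigma> \<in> L" "val w = val \<sigma>" by auto
      show "0 \<in> E w \<or> (\<exists>(q, c)\<in>R w. \<exists>\<rho>\<in>lists S. foldl \<delta> q \<rho> \<in> Acc \<and> c = val \<rho>)"
      proof (cases "length \<sigma> \<le> length w")
        case True
        then have "0 \<in> E w" unfolding E_def using \<sigma> by (auto simp: power_zero)
        then show ?thesis ..
      next
        case False
        define \<tau> \<rho> where "\<tau> = take (length w) \<sigma>" and "\<rho> = drop (length w) \<sigma>"
        have eq: "\<sigma> = \<tau> @ \<rho>" "length \<tau> = length w" using False by (auto simp: \<tau>_def \<rho>_def)
        have "val w = val \<tau> + (G ^^ length w) (val \<rho>)"
          using \<sigma> by (simp add: eq string_value_append[OF additive_G])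
        then have "(foldl \<delta> q0 \<tau>, val \<rho>) \<in> R w" unfolding R_def using \<sigma> eq L by auto
        moreover have "foldl \<delta> (foldl \<delta> q0 \<tau>) \<rho> \<in> Acc" "\<rho> \<in> lists S" using \<sigma> eq L by auto
        ultimately show ?thesis by blast
      qed
    next
      assume "0 \<in> E w \<or> (\<exists>(q, c)\<in>R w. \<exists>\<rho>\<in>lists S. foldl \<delta> q \<rho> \<in> Acc \<and> c = val \<rho>)"
      then show "val w \<in> val ` L"
      proof
        assume "0 \<in> E w"
        then show ?thesis unfolding E_def by (auto simp: power_zero)
      next
        assume "\<exists>(q, c)\<in>R w. \<exists>\<rho>\<in>lists S. foldl \<delta> q \<rho> \<in> Acc \<and> c = val \<rho>"
        then obtain \<tau> \<rho> where *: "\<tau> \<in> lists S" "length \<tau> = length w"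
          "val w = val \<tau> + (G ^^ length w) (val \<rho>)" "\<rho> \<in> lists S" "foldl \<delta> (foldl \<delta> q0 \<tau>) \<rho> \<in> Acc"
          unfolding R_def by blast
        then have "val w = val (\<tau> @ \<rho>)" by (simp add: string_value_append[OF additive_G])
        moreover have "\<tau> @ \<rho> \<in> L" unfolding L using * by auto
        ultimately show ?thesis by blast
      qed
    qed
    fix u v assume "u \<in> {w \<in> lists S. val w \<in> val ` L}" "v \<in> lists S" "(R u, E u) = (R v, E v)"
    then show "v \<in> {w \<in> lists S. val w \<in> val ` L}" using acc[of u] acc[of v] by simp
  qed auto
qed

text \<open>The part beyond \<open>length w\<close> letters can be exchanged for one fixed
  continuation per pair of state and carry, without changing the value or leaving \<open>L\<close>.
  There are finitely many such pairs.\<close>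

lemma bounded_excess:
  assumes "regular_language S L"
  obtains K where "\<And>w. w \<in> lists S \<Longrightarrow> val w \<in> val ` L \<Longrightarrow>
    \<exists>\<sigma>\<in>L. val \<sigma> = val w \<and> length \<sigma> \<le> length w + K"
proof -
  obtain Q :: "nat set" and \<delta> q0 Acc where fin: "finite Q" and q0: "q0 \<in> Q" and Acc: "Acc \<subseteq> Q"
    and \<delta>: "\<And>q s. q \<in> Q \<Longrightarrow> s \<in> S \<Longrightarrow> \<delta> q s \<in> Q"
    and L: "L = {w \<in> lists S. foldl \<delta> q0 w \<in> Acc}"
    using assms unfolding regular_language_def by blast
  have run: "foldl \<delta> q0 w \<in> Q" if "w \<in> lists S" for w
    using that by (induction w rule: rev_induct) (auto simp: q0 \<delta>)
  define P where "P q c \<rho> \<longleftrightarrow> \<rho> \<in> lists S \<and> foldl \<delta> q \<rho> \<in> Acc \<and> c = val \<rho>" for q c \<rho>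
  define pick where "pick q c = (SOME \<rho>. P q c \<rho>)" for q c
  have pick: "P q c (pick q c)" if "P q c \<rho>" for q c \<rho>
    unfolding pick_def using that by (rule someI)
  \<comment> \<open>For pairs without a continuation \<open>pick\<close> is arbitrary, which can
    only enlarge the maximum.\<close>
  define K where "K = Max ((\<lambda>(q, c). length (pick q c)) ` (Q \<times> S))"
  have K: "length (pick q c) \<le> K" if "q \<in> Q" "c \<in> S" for q c
    unfolding K_def using that fin finite_S by (intro Max_ge) auto
  show ?thesis
  proof (rule that[of K])
    fix w assume w: "w \<in> lists S" and "val w \<in> val ` L"
    then obtain \<sigma> where \<sigma>: "\<sigma> \<in> L" "val w = val \<sigma>" by auto
    show "\<exists>\<sigma>\<in>L. val \<sigma> = val w \<and> length \<sigma> \<le> length w + K"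
    proof (cases "length \<sigma> \<le> length w")
      case True
      then show ?thesis using \<sigma> by (intro bexI[of _ \<sigma>]) auto
    next
      case False
      define \<tau> \<rho> where "\<tau> = take (length w) \<sigma>" and "\<rho> = drop (length w) \<sigma>"
      have eq: "\<sigma> = \<tau> @ \<rho>" "length \<tau> = length w" using False by (auto simp: \<tau>_def \<rho>_def)
      have val: "val w = val \<tau> + (G ^^ length w) (val \<rho>)"
        using \<sigma> by (simp add: eq string_value_append[OF additive_G])
      have \<tau>: "\<tau> \<in> lists S" "\<rho> \<in> lists S" using \<sigma> eq L by auto
      define q \<rho>' where "q = foldl \<delta> q0 \<tau>" and "\<rho>' = pick q (val \<rho>)"
      have "P q (val \<rho>) \<rho>" using \<sigma> eq L by (auto simp: P_def q_def)
      then have \<rho>': "P q (val \<rho>) \<rho>'" unfolding \<rho>'_def by (rule pick)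
      have "length \<rho>' \<le> K"
        unfolding \<rho>'_def q_def using carry_in_S[OF eq(2) w \<tau>(1) val] \<tau> by (intro K run)
      moreover have "val (\<tau> @ \<rho>') = val w"
        using \<rho>' by (simp add: val string_value_append[OF additive_G] eq P_def)
      moreover have "\<tau> @ \<rho>' \<in> L" using \<rho>' \<tau> by (auto simp: P_def q_def L)
      ultimately show ?thesis using eq by (intro bexI[of _ "\<tau> @ \<rho>'"]) auto
    qed
  qed
qed

section \<open>Regular languages of representatives\<close>

text \<open>Among words of equal length and value the least one is kept. Uniqueness holds per length
  and not per element, since zero padding yields words of all larger lengths; this costs only a
  linear factor in the counting.\<close>

lemma regular_representatives:
  assumes "regular_language S {w \<in> lists S. val w \<in> A}"
  obtains L where "regular_language S L" "A = val ` L" "L \<subseteq> lists S"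
    "\<And>u v. u \<in> L \<Longrightarrow> v \<in> L \<Longrightarrow> length u = length v \<Longrightarrow> val u = val v \<Longrightarrow> u = v"
proof -
  obtain Q :: "nat set" and \<delta> q0 Acc where fin: "finite Q" and q0: "q0 \<in> Q" and Acc: "Acc \<subseteq> Q"
    and \<delta>: "\<And>q s. q \<in> Q \<Longrightarrow> s \<in> S \<Longrightarrow> \<delta> q s \<in> Q"
    and LA: "{w \<in> lists S. val w \<in> A} = {w \<in> lists S. foldl \<delta> q0 w \<in> Acc}"
    using assms unfolding regular_language_def by blast
  have run: "foldl \<delta> q0 w \<in> Q" if "w \<in> lists S" for w
    using that by (induction w rule: rev_induct) (auto simp: q0 \<delta>)
  \<comment> \<open>The order on letters serves twice: well-foundedness yields a least word,
    totality makes it unique.\<close>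
  obtain ord0 :: "('a \<times> 'a) set" where wo: "well_order_on UNIV ord0"
    using well_order_on by blast
  define ord where "ord = ord0 - Id"
  have wf: "wf ord" and total: "total ord"
    using wo unfolding well_order_on_def linear_order_on_def ord_def by auto
  \<comment> \<open>The last letter is the most significant one, so that appending letters updates the
    comparison without looking back.\<close>
  define less where "less u v \<longleftrightarrow> (rev u, rev v) \<in> lenlex ord" for u v
  have less_snoc: "less (u @ [s]) (v @ [t]) \<longleftrightarrow> (s, t) \<in> ord \<or> s = t \<and> less u v"
    if "length u = length v" for u v s t
    using that by (simp add: less_def Cons_lenlex_iff)
  define L where "L = {w \<in> lists S. val w \<in> A \<and>
      (\<forall>\<tau>\<in>lists S. length \<tau> = length w \<longrightarrow> val w = val \<tau> \<longrightarrow> \<not> less \<tau> w)}"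
  \<comment> \<open>All competitors of the same length are tracked, each by its carry and a flag
    telling whether it is smaller than \<open>w\<close>. The pair \<open>(0, True)\<close> signals a
    smaller word of the same value.\<close>
  define B where "B w = {(c, less \<tau> w) | \<tau> c. \<tau> \<in> lists S \<and> length \<tau> = length w \<and>
      val w = val \<tau> + (G ^^ length w) c}" for w
  have B_snoc: "B (w @ [s]) = {(c, (t, s) \<in> ord \<or> t = s \<and> b) | t c b. t \<in> S \<and> (G c - s + t, b) \<in> B w}" for w s
  proof (intro equalityI subsetI)
    fix x assume "x \<in> B (w @ [s])"
    then obtain \<tau> c where x: "x = (c, less \<tau> (w @ [s]))" and \<tau>: "\<tau> \<in> lists S" "length \<tau> = Suc (length w)"
      "val (w @ [s]) = val \<tau> + (G ^^ Suc (length w)) c"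
      unfolding B_def by auto
    then obtain \<tau>' t where \<tau>': "\<tau> = \<tau>' @ [t]" by (cases \<tau> rule: rev_cases) auto
    have "val w = val \<tau>' + (G ^^ length w) (G c - s + t)"
      using \<tau> carry_snoc[of \<tau>' w s t c] by (simp add: \<tau>')
    then have "(G c - s + t, less \<tau>' w) \<in> B w" unfolding B_def using \<tau> \<tau>' by auto
    then show "x \<in> {(c, (t, s) \<in> ord \<or> t = s \<and> b) | t c b. t \<in> S \<and> (G c - s + t, b) \<in> B w}"
      using x \<tau> \<tau>' by (auto simp: less_snoc)
  next
    fix x assume "x \<in> {(c, (t, s) \<in> ord \<or> t = s \<and> b) | t c b. t \<in> S \<and> (G c - s + t, b) \<in> B w}"
    then obtain \<tau> t c where x: "x = (c, (t, s) \<in> ord \<or> t = s \<and> less \<tau> w)" and t: "t \<in> S"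
      and \<tau>: "\<tau> \<in> lists S" "length \<tau> = length w" "val w = val \<tau> + (G ^^ length w) (G c - s + t)"
      unfolding B_def by auto
    have "val (w @ [s]) = val (\<tau> @ [t]) + (G ^^ Suc (length w)) c"
      using carry_snoc \<tau> by blast
    then show "x \<in> B (w @ [s])" unfolding B_def using x t \<tau>
      by (auto simp: less_snoc intro!: exI[of _ "\<tau> @ [t]"])
  qed
  have L_iff: "w \<in> L \<longleftrightarrow> foldl \<delta> q0 w \<in> Acc \<and> (0, True) \<notin> B w" if "w \<in> lists S" for w
  proof -
    have "val w \<in> A \<longleftrightarrow> foldl \<delta> q0 w \<in> Acc" using that LA by auto
    then show ?thesis using that unfolding L_def B_def by (auto simp: power_zero)
  qed
  have "finite ((\<lambda>w. (foldl \<delta> q0 w, B w)) ` lists S)"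
  proof (rule finite_subset)
    show "(\<lambda>w. (foldl \<delta> q0 w, B w)) ` lists S \<subseteq> Q \<times> Pow (S \<times> UNIV)"
      unfolding B_def using run carry_in_S by blast
  qed (simp add: fin finite_S)
  then have "regular_language S L"
  proof (rule regular_languageI)
    show "L \<subseteq> lists S" unfolding L_def by auto
    fix u v assume uv: "u \<in> L" "v \<in> lists S" "(foldl \<delta> q0 u, B u) = (foldl \<delta> q0 v, B v)"
    then have "u \<in> lists S" unfolding L_def by auto
    then show "v \<in> L" using L_iff[of u] L_iff[of v] uv by simp
  qed (simp add: B_snoc)
  moreover have "A = val ` L"
  proof (intro equalityI subsetI)
    fix a assume a: "a \<in> A"
    obtain w where w: "w \<in> lists S" "val w = a" using ex_word by blast
    define X where "X = {u \<in> lists S. length u = length w \<and> val u = a}"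
    have wf': "wf (inv_image (lenlex ord) rev)" using wf by (simp add: wf_lenlex)
    have "w \<in> X" using w by (simp add: X_def)
    then obtain z where z: "z \<in> X" "\<And>y. (rev y, rev z) \<in> lenlex ord \<Longrightarrow> y \<notin> X"
      using wfE_min[OF wf'] by (metis in_inv_image)
    then have "z \<in> L" using a unfolding L_def less_def X_def mem_Collect_eq by metis
    then show "a \<in> val ` L" using z by (auto simp: X_def)
  qed (auto simp: L_def)
  moreover have "u = v" if "u \<in> L" "v \<in> L" "length u = length v" "val u = val v" for u v
  proof (rule ccontr)
    assume "u \<noteq> v"
    then have "less u v \<or> less v u"
      using total_lenlex[OF total] unfolding less_def total_on_def by auto
    then show False using that unfolding L_def by auto
  qed
  moreover have "L \<subseteq> lists S" unfolding L_def by auto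
  ultimately show ?thesis using that by blast
qed

section \<open>Length functions against word length\<close>

text \<open>Words are read in blocks of \<open>K\<close> letters. For the upper bound, each added
  block costs a factor \<open>D\<close>, which is absorbed by the next power of \<open>B\<close> as
  \<open>D \<le> B\<close>. Conversely, in a word for \<open>a\<close> the rest after
  \<open>K * n\<close> letters has a value in a finite set, by the expansion of
  \<open>G ^^ (K * n)\<close>, and is replaced by a fixed word.\<close>

lemma length_vs_word_length:
  assumes len: "length_function (F ^^ r) len" and G: "G = F ^^ j" and "r > 0" "j > 0"
  obtains K N M B where "B > 1"
    "\<And>w n. w \<in> lists S \<Longrightarrow> length w \<le> n \<Longrightarrow> len (val w) \<le> M * B ^ n"
    "\<And>a n. len a \<le> B ^ n \<Longrightarrow> \<exists>w\<in>lists S. length w \<le> K * n + N \<and> val w = a"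
proof -
  obtain k D B E A\<^sub>0 where k: "k > 0" and D: "D \<ge> 1" and B: "B > 1" "D \<le> B" and E: "E \<ge> 1"
    and A\<^sub>0: "finite A\<^sub>0"
    and add: "\<And>a b. len (a + b) \<le> D * max (len a) (len b)"
    and up0: "\<And>a. len (((F ^^ r) ^^ (j * k)) a) \<le> B * len a"
    and low0: "\<And>a n. a \<notin> A\<^sub>0 \<Longrightarrow> B ^ n / E * len a \<le> len (((F ^^ r) ^^ (j * k * n)) a)"
    using length_function_powerE[OF len \<open>j > 0\<close>] by metis
  have nonneg: "0 \<le> len a" and sym: "len (- a) = len a" and fin: "finite {a. len a \<le> x}" for a x
    using len unfolding length_function_def by auto
  \<comment> \<open>\<open>(F ^^ r) ^^ (j * k)\<close> equals \<open>G ^^ (r * k)\<close>; this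
    common power links the length function for \<open>F ^^ r\<close> with words evaluated by
    \<open>G\<close>.\<close>
  define K where "K = r * k"
  have "K > 0" using k \<open>r > 0\<close> by (simp add: K_def)
  have pow: "(F ^^ r) ^^ (j * k * n) = G ^^ (K * n)" for n
    unfolding G K_def funpow_mult by (simp add: mult.assoc mult.left_commute)
  have up: "len ((G ^^ K) a) \<le> B * len a" for a
    using up0[of a] pow[of 1] by simp
  have low: "B ^ n / E * len a \<le> len ((G ^^ (K * n)) a)" if "a \<notin> A\<^sub>0" for a n
    using low0[OF that, of n] pow[of n] by simp
  have iter: "len ((G ^^ (K * n)) a) \<le> B ^ n * len a" for n a
  proof (induction n)
    case (Suc n)
    have "len ((G ^^ (K * Suc n)) a) \<le> B * len ((G ^^ (K * n)) a)"
      using up by (simp add: funpow_add)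
    also have "\<dots> \<le> B * (B ^ n * len a)" using B Suc by (intro mult_left_mono) auto
    finally show ?case by simp
  qed simp
  have finK: "finite {w \<in> lists S. length w = K}"
    using finite_lists_length_eq[OF finite_S, of K] by (simp add: lists_eq_set)
  define M where "M = Max (len ` val ` {w \<in> lists S. length w = K})"
  have M: "len (val w) \<le> M" if "w \<in> lists S" "length w = K" for w
    unfolding M_def using that finK by (intro Max_ge) auto
  have zero: "len 0 \<le> M"
    using M[of "replicate K 0"] zero_S string_value_pad[OF additive_G, of "[]" K]
    by (auto simp: in_lists_conv_set)
  have "M \<ge> 0" using zero nonneg[of 0] by simp
  have block: "len (val w) \<le> D * M * B ^ n" if "w \<in> lists S" "length w = K * n" for w n
    using that
  proof (induction n arbitrary: w)
    case 0
    have "1 * M \<le> D * M" using D \<open>M \<ge> 0\<close> by (intro mult_right_mono)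
    then show ?case using 0 zero by simp
  next
    case (Suc n)
    define u v where "u = take (K * n) w" and "v = drop (K * n) w"
    have w: "w = u @ v" "length u = K * n" "length v = K" using Suc by (auto simp: u_def v_def)
    then have uv: "u \<in> lists S" "v \<in> lists S" using Suc by auto
    have DM: "D * M \<ge> 0" using D \<open>M \<ge> 0\<close> by simp
    have "len ((G ^^ (K * n)) (val v)) \<le> B ^ n * M"
      using iter[of n "val v"] M[of v] uv w B
      by (meson mult_left_mono order_trans zero_le_power less_imp_le zero_less_one less_trans)
    also have "\<dots> \<le> D * M * B ^ n"
      using mult_right_mono[of 1 D "B ^ n * M"] D B \<open>M \<ge> 0\<close> by (simp add: mult_ac)
    finally have "max (len (val u)) (len ((G ^^ (K * n)) (val v))) \<le> D * M * B ^ n"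
      using Suc.IH[of u] uv w by simp
    then have "len (val w) \<le> D * (D * M * B ^ n)"
      using add[of "val u" "(G ^^ (K * n)) (val v)"] D w
      by (smt (verit) mult_left_mono string_value_append[OF additive_G])
    also have "\<dots> \<le> B * (D * M * B ^ n)" using B DM by (intro mult_right_mono) auto
    finally show ?case by (simp add: mult_ac)
  qed
  \<comment> \<open>Found by solving
    \<open>B ^ n / E * len b \<le> D * max (len a) (len (val u))\<close> for \<open>len b\<close>;
    both lengths on the right are at most \<open>max 1 (D * M) * B ^ n\<close>.\<close>
  define Y where "Y = E * D * max 1 (D * M)"
  have finY: "finite (A\<^sub>0 \<union> {b. len b \<le> Y})" using A\<^sub>0 fin by simp
  obtain rep where rep: "\<And>a. rep a \<in> lists S \<and> val (rep a) = a"
    using ex_word by metis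
  define N where "N = Max (length ` rep ` (A\<^sub>0 \<union> {b. len b \<le> Y}))"
  have N: "length (rep b) \<le> N" if "b \<in> A\<^sub>0 \<union> {b. len b \<le> Y}" for b
    unfolding N_def using that finY by (intro Max_ge finite_imageI imageI)
  show ?thesis
  proof (rule that[of B "D * M" K N])
    fix w n assume w: "w \<in> lists S" "length w \<le> n"
    have "n \<le> K * n" using \<open>K > 0\<close> by simp
    then have le: "length w \<le> K * n" using w(2) by (rule order_trans[rotated])
    then have "len (val (w @ replicate (K * n - length w) 0)) \<le> D * M * B ^ n"
      using w zero_S by (intro block) auto
    then show "len (val w) \<le> D * M * B ^ n" by (simp add: string_value_pad[OF additive_G])
  next
    fix a n assume a: "len a \<le> B ^ n"
    obtain w where w: "w \<in> lists S" "val w = a" using ex_word by blast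
    show "\<exists>w\<in>lists S. length w \<le> K * n + N \<and> val w = a"
    proof (cases "length w \<le> K * n")
      case True
      then show ?thesis using w by (intro bexI[of _ w]) auto
    next
      case False
      define u b where "u = take (K * n) w" and "b = val (drop (K * n) w)"
      have u: "u \<in> lists S" "length u = K * n"
        using w False by (auto simp: u_def dest: in_set_takeD)
      have a_eq: "a = val u + (G ^^ (K * n)) b"
        using string_value_append[OF additive_G, of u "drop (K * n) w"] w u
        by (simp add: u_def b_def)
      have "b \<in> A\<^sub>0 \<union> {b. len b \<le> Y}"
      proof (cases "b \<in> A\<^sub>0")
        case False
        have "B ^ n / E * len b \<le> len (a + - val u)"
          using low[OF False, of n] by (simp add: a_eq)
        also have "\<dots> \<le> D * max (len a) (len (val u))"
          using add[of a "- val u"] by (simp add: sym)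
        also have "\<dots> \<le> D * (max 1 (D * M) * B ^ n)"
        proof (intro mult_left_mono)
          have "1 * B ^ n \<le> max 1 (D * M) * B ^ n" "D * M * B ^ n \<le> max 1 (D * M) * B ^ n"
            using B by (intro mult_right_mono; simp)+
          then show "max (len a) (len (val u)) \<le> max 1 (D * M) * B ^ n"
            using a block[OF u] by simp
        qed (use D in simp)
        finally have "len b * B ^ n \<le> Y * B ^ n"
          using E by (simp add: Y_def field_simps)
        then show ?thesis using B by simp
      qed simp
      then have "length (u @ rep b) \<le> K * n + N" using N u by simp
      moreover have "val (u @ rep b) = a"
        using rep u by (simp add: string_value_append[OF additive_G] a_eq)
      ultimately show ?thesis using u rep by (intro bexI[of _ "u @ rep b"]) auto
    qed
  qed (use B in simp)
qed

section \<open>Polynomial and polylogarithmic counting\<close>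

lemma finite_words: "finite {w \<in> lists S. length w \<le> n}"
  using finite_lists_length_le[OF finite_S, of n] by (simp add: lists_eq_set)

text \<open>An element of length at most \<open>x\<close> has a word of length
  \<open>O(log x)\<close>, and by \<open>bounded_excess\<close> also one in \<open>L\<close> that is
  only boundedly longer. So the elements are counted by polynomially many words in
  \<open>log x\<close>.\<close>

lemma length_sparse_image:
  assumes len: "length_function (F ^^ r) len" and G: "G = F ^^ j" and "r > 0" "j > 0"
    and L: "sparse_language S L"
  shows "length_sparse len (val ` L)"
proof -
  obtain K N M B where B: "B > 1"
    and short: "\<And>a n. len a \<le> B ^ n \<Longrightarrow> \<exists>w\<in>lists S. length w \<le> K * n + N \<and> val w = a"
    using length_vs_word_length[OF assms(1-4)] by metis
  obtain p :: "real poly" where p: "\<And>x :: nat. real (card {w \<in> L. length w \<le> x}) \<le> poly p (real x)"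
    and reg: "regular_language S L"
    using L unfolding sparse_language_def by blast
  have LS: "L \<subseteq> lists S" using reg unfolding regular_language_def by blast
  obtain K' where K': "\<And>w. w \<in> lists S \<Longrightarrow> val w \<in> val ` L \<Longrightarrow>
      \<exists>\<sigma>\<in>L. val \<sigma> = val w \<and> length \<sigma> \<le> length w + K'"
    using bounded_excess[OF reg] by blast
  obtain c d where c: "c > 0" "\<And>y. y \<ge> 0 \<Longrightarrow> poly p y \<le> c * (y + 1) ^ d"
    using poly_le_power by blast
  \<comment> \<open>Chosen so that \<open>K * n + N + K' + 1 \<le> \<kappa> * ln x\<close> when
    \<open>n \<le> log B x + 1\<close>. The constant terms are multiplied by \<open>ln x\<close>,
    which is why \<open>x \<ge> exp 1\<close> is required below.\<close>
  define \<kappa> where "\<kappa> = real K / ln B + real K + real (N + K') + 1"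
  have bound: "real (card {a \<in> val ` L. len a \<le> x}) \<le> c * \<kappa> ^ d * ln x ^ d" if x: "x \<ge> exp 1" for x
  proof -
    have x0: "x > 0" using x exp_gt_zero[of 1] by linarith
    have lnx: "ln x \<ge> 1" using x x0 by (simp add: ln_ge_iff)
    have lnB: "ln B > 0" using B by simp
    define n where "n = nat \<lceil>log B x\<rceil>"
    have logx: "log B x > 0" using lnx lnB by (simp add: log_def)
    then have n: "log B x \<le> real n" "real n \<le> log B x + 1" unfolding n_def by linarith+
    have "x = B powr log B x" using B x0 by simp
    also have "\<dots> \<le> B powr real n" using B n by (intro powr_mono) auto
    finally have xn: "x \<le> B ^ n" using B by (simp add: powr_realpow)
    have "{a \<in> val ` L. len a \<le> x} \<subseteq> val ` {w \<in> L. length w \<le> K * n + N + K'}"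
    proof
      fix a assume a: "a \<in> {a \<in> val ` L. len a \<le> x}"
      then obtain w where w: "w \<in> lists S" "length w \<le> K * n + N" "val w = a"
        using short[of a n] xn by auto
      obtain \<sigma> where "\<sigma> \<in> L" "val \<sigma> = a" "length \<sigma> \<le> length w + K'"
        using K'[OF w(1)] w(3) a by auto
      then show "a \<in> val ` {w \<in> L. length w \<le> K * n + N + K'}" using w by force
    qed
    moreover have fin: "finite {w \<in> L. length w \<le> K * n + N + K'}"
      using LS by (intro finite_subset[OF _ finite_words]) auto
    ultimately have "card {a \<in> val ` L. len a \<le> x} \<le> card {w \<in> L. length w \<le> K * n + N + K'}"
      by (meson card_image_le card_mono finite_imageI order_trans)
    then have "real (card {a \<in> val ` L. len a \<le> x}) \<le> poly p (real (K * n + N + K'))"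
      using p[of "K * n + N + K'"] by linarith
    also have "\<dots> \<le> c * (real (K * n + N + K') + 1) ^ d" by (rule c) simp
    also have "\<dots> \<le> c * (\<kappa> * ln x) ^ d"
    proof -
      have "real K * real n \<le> real K * (ln x / ln B + 1)"
        using n by (intro mult_left_mono) (auto simp: log_def)
      moreover have "(real K + real (N + K') + 1) * 1 \<le> (real K + real (N + K') + 1) * ln x"
        using lnx by (intro mult_left_mono) auto
      ultimately have "real (K * n + N + K') + 1 \<le> \<kappa> * ln x"
        by (simp add: \<kappa>_def algebra_simps)
      then show ?thesis using c(1) by (intro mult_left_mono power_mono) auto
    qed
    finally show ?thesis by (simp add: power_mult_distrib mult_ac)
  qed
  have "(\<lambda>x. real (card {a \<in> val ` L. len a \<le> x})) \<in> O(\<lambda>x. ln x ^ d)"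
  proof (rule bigoI[of _ "c * \<kappa> ^ d"])
    show "\<forall>\<^sub>F x in at_top. norm (real (card {a \<in> val ` L. len a \<le> x})) \<le> c * \<kappa> ^ d * norm (ln x ^ d)"
      using eventually_ge_at_top[of "exp 1 :: real"]
    proof eventually_elim
      case (elim x)
      then have "ln x \<ge> 0" using exp_gt_one[of 1] by (intro ln_ge_zero) linarith
      then show ?case using bound[OF elim] by simp
    qed
  qed
  then show ?thesis unfolding length_sparse_def by blast
qed

text \<open>Length and value together determine a word of \<open>L\<close>. Hence the words of
  length at most \<open>n\<close> number at most \<open>n + 1\<close> times the elements of length
  at most a multiple of \<open>B ^ n\<close>, and the logarithm of that bound is affine in
  \<open>n\<close>.\<close>

lemma sparse_languageI:
  assumes len: "length_function (F ^^ r) len" and G: "G = F ^^ j" and "r > 0" "j > 0"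
    and reg: "regular_language S L" and sparse: "length_sparse len (val ` L)"
    and uniq: "\<And>u v. u \<in> L \<Longrightarrow> v \<in> L \<Longrightarrow> length u = length v \<Longrightarrow> val u = val v \<Longrightarrow> u = v"
  shows "sparse_language S L"
proof -
  obtain K N :: nat and M B where B: "B > 1"
    and upper: "\<And>w n. w \<in> lists S \<Longrightarrow> length w \<le> n \<Longrightarrow> len (val w) \<le> M * B ^ n"
    using length_vs_word_length[OF assms(1-4)] by metis
  have LS: "L \<subseteq> lists S" using reg unfolding regular_language_def by blast
  have fin: "finite {a. len a \<le> x}" for x using len unfolding length_function_def by blast
  obtain d where "(\<lambda>x. real (card {a \<in> val ` L. len a \<le> x})) \<in> O(\<lambda>x. ln x ^ d)"
    using sparse unfolding length_sparse_def by blast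
  then obtain c where "\<forall>\<^sub>F x in at_top. norm (real (card {a \<in> val ` L. len a \<le> x})) \<le> c * norm (ln x ^ d)"
    by (rule landau_o.bigE)
  then obtain x0 where x0: "\<And>x. x \<ge> x0 \<Longrightarrow> real (card {a \<in> val ` L. len a \<le> x}) \<le> c * \<bar>ln x ^ d\<bar>"
    unfolding eventually_at_top_linorder by auto
  \<comment> \<open>\<open>M' \<ge> x0\<close> makes the asymptotic bound available for every
    \<open>n\<close>, and \<open>M' \<ge> 1\<close> keeps the logarithm nonnegative, so that the
    absolute value disappears.\<close>
  define M' where "M' = max 1 (max M x0)"
  have M': "M' \<ge> 1" "M' \<ge> M" "M' \<ge> x0" unfolding M'_def by auto
  define p where "p = [:1, 1:] * smult c ([:ln M', ln B:] ^ d)"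
  have "real (card {w \<in> L. length w \<le> n}) \<le> poly p (real n)" for n
  proof -
    define x where "x = M' * B ^ n"
    have Bn: "B ^ n \<ge> 1" using B by simp
    have "M' * 1 \<le> x" unfolding x_def using Bn M' by (intro mult_left_mono) auto
    then have x: "x \<ge> x0" using M' by simp
    have ln: "ln x = ln M' + real n * ln B"
      using M' B by (simp add: x_def ln_mult ln_realpow)
    have "card {w \<in> L. length w \<le> n} \<le> card ({..n} \<times> {a \<in> val ` L. len a \<le> x})"
    proof (rule card_inj_on_le[of "\<lambda>w. (length w, val w)"])
      show "inj_on (\<lambda>w. (length w, val w)) {w \<in> L. length w \<le> n}"
        by (auto intro!: inj_onI uniq)
      have "M * B ^ n \<le> x" unfolding x_def using M' Bn by (intro mult_right_mono) auto
      then show "(\<lambda>w. (length w, val w)) ` {w \<in> L. length w \<le> n} \<subseteq> {..n} \<times> {a \<in> val ` L. len a \<le> x}"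
        using upper LS by fastforce
      show "finite ({..n} \<times> {a \<in> val ` L. len a \<le> x})"
        using fin[of x] by (auto intro: finite_subset[rotated])
    qed
    then have "real (card {w \<in> L. length w \<le> n}) \<le> real (n + 1) * real (card {a \<in> val ` L. len a \<le> x})"
      unfolding of_nat_mult[symmetric] by (simp add: card_cartesian_product del: of_nat_mult)
    also have "\<dots> \<le> real (n + 1) * (c * \<bar>ln x ^ d\<bar>)"
      using x0[OF x] by (intro mult_left_mono) auto
    also have "\<bar>ln x ^ d\<bar> = (ln M' + real n * ln B) ^ d"
      using M' B by (simp add: ln)
    finally show ?thesis by (simp add: p_def algebra_simps)
  qed
  then show ?thesis unfolding sparse_language_def using reg by blast
qed

end

section \<open>Equivalence of sparseness with automaticity and polylogarithmic growth\<close>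

theorem theorem5p9:
  fixes F :: "'a::ab_group_add \<Rightarrow> 'a"
    and r :: nat
    and len :: "'a \<Rightarrow> real"
    and A :: "'a set"
  assumes "infinite (UNIV :: 'a set)"
    and "additive F"
    and "inj F"
    and "r > 0"
    and "length_function (F ^^ r) len"
  shows "sparse_set F A \<longleftrightarrow> automatic_set F A \<and> length_sparse len A"
proof
  assume "sparse_set F A"
  then obtain j S L where j: "j > 0" and S: "spanning_set (F ^^ j) S"
    and L: "sparse_language S L" and A: "A = string_value (F ^^ j) ` L"
    unfolding sparse_set_def by blast
  interpret spanned_group "F ^^ j" S
    by (intro spanned_group.intro additive_funpow inj_fn S assms(2,3))
  have "regular_language S {w \<in> lists S. val w \<in> A}"
    unfolding A using L by (intro regular_preimage) (simp add: sparse_language_def)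
  then have "automatic_set F A" unfolding automatic_set_def using j S by blast
  moreover have "length_sparse len A"
    unfolding A by (rule length_sparse_image[OF assms(5) refl assms(4) j L])
  ultimately show "automatic_set F A \<and> length_sparse len A" ..
next
  assume A: "automatic_set F A \<and> length_sparse len A"
  then obtain j S where j: "j > 0" and S: "spanning_set (F ^^ j) S"
    and reg: "regular_language S {w \<in> lists S. string_value (F ^^ j) w \<in> A}"
    unfolding automatic_set_def by blast
  interpret spanned_group "F ^^ j" S
    by (intro spanned_group.intro additive_funpow inj_fn S assms(2,3))
  \<comment> \<open>The language of all words for \<open>A\<close> may contain many words of one
    length for the same element, so representatives are counted instead.\<close>
  obtain L where L: "regular_language S L" "A = val ` L"
    "\<And>u v. u \<in> L \<Longrightarrow> v \<in> L \<Longrightarrow> length u = length v \<Longrightarrow> val u = val v \<Longrightarrow> u = v"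
    using regular_representatives[OF reg] by metis
  have "sparse_language S L"
    using sparse_languageI[OF assms(5) refl assms(4) j L(1)] L A by blast
  then show "sparse_set F A" unfolding sparse_set_def using j S L by blast
qed

end
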